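(* Let $N\ge 2$ and $h_2^{(N)}=\sum_{1\le i<j\le N}\sigma_z^{i}\sigma_z^{j}$ on $(\mathbb{C}^2)^{\otimes N}$. Then the maximum over all unit vectors $|\psi\rangle$ of $4\left(\langle\psi|(h_2^{(N)})^2|\psi\rangle-\langle\psi|h_2^{(N)}|\psi\rangle^2\right)$ equals $$\frac{1}{16}\left(2N^2-1+(-1)^N\right)^2 .$$
   Context: $\sigma_z^{i}$ denotes $\sigma_z=\mathrm{diag}(1,-1)$ acting on the $i$-th qubit and as the identity on the others. The maximized quantity is the quantum Fisher information for estimating $J$ in the encoding Hamiltonian $Jh_2^{(N)}$ with pure probe $|\psi\rangle$. *)

theory Defs
  imports "Jordan_Normal_Form.Matrix"
begin

text \<open>
  The space \<open>(\<complex>\<^sup>2)\<^sup>\<otimes>\<^sup>N\<close> is represented by \<^term>\<open>carrier_vec (2 ^ N) :: complex vec set\<close> through the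
  Kronecker product, the first tensor factor being the most significant one.
\<close>

definition kronecker :: "'a :: semiring_1 mat \<Rightarrow> 'a mat \<Rightarrow> 'a mat" (infixr "\<Otimes>" 70) where
  "A \<Otimes> B = mat (dim_row A * dim_row B) (dim_col A * dim_col B)
     (\<lambda>(r, c). A $$ (r div dim_row B, c div dim_col B) * B $$ (r mod dim_row B, c mod dim_col B))"

definition kronecker_list :: "'a :: semiring_1 mat list \<Rightarrow> 'a mat" where
  "kronecker_list As = foldr (\<Otimes>) As (1\<^sub>m 1)"

definition sigma_z :: "complex mat" where
  "sigma_z = mat_of_rows_list 2 [[1, 0], [0, -1]]"

definition sigma_z_at :: "nat \<Rightarrow> nat \<Rightarrow> complex mat" where
  "sigma_z_at N i = kronecker_list (map (\<lambda>k. if k = i then sigma_z else 1\<^sub>m 2) [1..<Suc N])"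

definition h2 :: "nat \<Rightarrow> complex mat" where
  "h2 N = finsum (module_mat TYPE(complex) (2 ^ N) (2 ^ N))
     (\<lambda>(i, j). sigma_z_at N i * sigma_z_at N j) {(i, j). 1 \<le> i \<and> i < j \<and> j \<le> N}"

definition unit_vectors :: "nat \<Rightarrow> complex vec set" where
  "unit_vectors N = {\<psi> \<in> carrier_vec (2 ^ N). \<psi> \<bullet>c \<psi> = 1}"

text \<open>
  The operation \<open>\<bullet>c\<close> conjugates its second argument, so \<open>\<langle>\<psi>|A|\<psi>\<rangle>\<close> has \<open>\<psi>\<close> on the right.
\<close>

definition expectation_value :: "complex mat \<Rightarrow> complex vec \<Rightarrow> complex" where
  "expectation_value A \<psi> = (A *\<^sub>v \<psi>) \<bullet>c \<psi>"

text \<open>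
  For complex numbers \<open>x \<le> y\<close> means \<open>Re x \<le> Re y\<close> and \<open>Im x = Im y\<close>, so a real maximum of a set of
  complex numbers also asserts that all its elements are real.
\<close>

definition is_maximum_of :: "'a :: order \<Rightarrow> 'a set \<Rightarrow> bool" where
  "is_maximum_of m S \<longleftrightarrow> m \<in> S \<and> (\<forall>x\<in>S. x \<le> m)"

lemma kronecker_carrier:
  "A \<in> carrier_mat a b \<Longrightarrow> B \<in> carrier_mat c d \<Longrightarrow> A \<Otimes> B \<in> carrier_mat (a * c) (b * d)"
  unfolding kronecker_def by auto

lemma sigma_z_carrier: "sigma_z \<in> carrier_mat 2 2"
  unfolding sigma_z_def mat_of_rows_list_def by auto

lemma kronecker_list_carrier:
  "(\<And>A. A \<in> set As \<Longrightarrow> A \<in> carrier_mat 2 2) \<Longrightarrow>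
   kronecker_list As \<in> carrier_mat (2 ^ length As) (2 ^ length As)"
proof (induction As)
  case (Cons A As)
  then have "A \<in> carrier_mat 2 2"
    and "kronecker_list As \<in> carrier_mat (2 ^ length As) (2 ^ length As)" by auto
  from kronecker_carrier[OF this] show ?case by (simp add: kronecker_list_def)
qed (simp add: kronecker_list_def)

lemma sigma_z_at_carrier: "sigma_z_at N i \<in> carrier_mat (2 ^ N) (2 ^ N)"
proof -
  let ?As = "map (\<lambda>k. if k = i then sigma_z else 1\<^sub>m 2) [1..<Suc N]"
  have "A \<in> carrier_mat 2 2" if "A \<in> set ?As" for A
    using that sigma_z_carrier by (auto split: if_splits)
  from kronecker_list_carrier[of ?As, OF this] show ?thesis
    by (simp add: sigma_z_at_def del: upt_Suc)
qed

lemma h2_carrier: "h2 N \<in> carrier_mat (2 ^ N) (2 ^ N)"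
proof -
  interpret M: abelian_monoid "module_mat TYPE(complex) (2 ^ N) (2 ^ N)"
    using abelian_group_mat[where ?'a = complex, of "2 ^ N" "2 ^ N"] by (simp add: abelian_group_def)
  show ?thesis
    unfolding h2_def using M.finsum_closed[of "\<lambda>(i, j). sigma_z_at N i * sigma_z_at N j"
      "{(i, j). 1 \<le> i \<and> i < j \<and> j \<le> N}"] sigma_z_at_carrier
    by (auto simp: module_mat_simps Pi_def intro!: mult_carrier_mat)
qed

end

(*
  In the computational basis h_2 is diagonal with eigenvalues (M^2 - N) / 2, where M is the sum of
  the N spins. As M has the parity of N, M^2 ranges between (N mod 2) and N^2, and both bounds are
  attained. By Popoviciu's inequality the variance is at most a quarter of the squared distance of
  the extreme eigenvalues, with equality for a balanced superposition of their eigenvectors.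
*)
theory Submission
  imports Defs
begin

text \<open>The pair \<open>(r div n, r mod n)\<close> determines \<open>r\<close>, so a product of
  diagonal entries can survive only on the diagonal.\<close>

lemma kronecker_mat_diag:
  "mat_diag m f \<Otimes> mat_diag n g = mat_diag (m * n) (\<lambda>r. f (r div n) * g (r mod n))"
proof -
  have lt: "r div n < m" "r mod n < n" if "r < m * n" for r
    using that by (simp_all add: less_mult_imp_div_less) (cases "n = 0", auto)
  have eq: "r = c" if "r div n = c div n" "r mod n = c mod n" for r c
    using that by (metis div_mult_mod_eq)
  show ?thesis
    by (rule eq_matI) (auto simp: kronecker_def mat_diag_def lt dest: eq)
qed

lemma sigma_z_eq_mat_diag: "sigma_z = mat_diag 2 (\<lambda>b. if b \<noteq> 0 then - 1 else 1)"
  by (rule eq_matI)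
     (auto simp: sigma_z_def mat_diag_def mat_of_rows_list_def less_2_cases_iff)

text \<open>Induction peels off the first tensor factor, so the interval must start at an arbitrary
  \<open>a\<close>. The tail may then miss position \<open>i\<close>, which the range test on
  \<open>i\<close> accounts for. As the first factor is the most significant, position
  \<open>i\<close> sits in bit \<open>a + n - Suc i\<close>.\<close>

lemma kronecker_list_sigma_z:
  "kronecker_list (map (\<lambda>k. if k = i then sigma_z else 1\<^sub>m 2) [a..<a + n]) =
   mat_diag (2 ^ n) (\<lambda>r. if a \<le> i \<and> i < a + n \<and> bit r (a + n - Suc i) then - 1 else 1)"
proof (induction n arbitrary: a)
  case 0
  show ?case by (auto simp: kronecker_list_def mat_diag_def intro!: eq_matI)
next
  case (Suc n)
  have upt: "[a..<a + Suc n] = a # [Suc a..<Suc a + n]"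
    using upt_conv_Cons[of a "a + Suc n"] by simp
  have head: "(if a = i then sigma_z else 1\<^sub>m 2) = mat_diag 2 (\<lambda>b. if a = i \<and> b \<noteq> 0 then - 1 else 1)"
    by (cases "a = i") (simp_all add: sigma_z_eq_mat_diag)
  \<comment> \<open>The head factor reads only the leading bit of \<open>r\<close>, and the tail
    only the \<open>n\<close> bits below it.\<close>
  have top: "bit r n \<longleftrightarrow> r div 2 ^ n \<noteq> 0" if "r < 2 ^ Suc n" for r :: nat
  proof -
    have "r div 2 ^ n < 2" using that by (simp add: less_mult_imp_div_less)
    then show ?thesis by (auto simp: bit_iff_odd less_2_cases_iff)
  qed
  have low: "bit (r mod 2 ^ n) k \<longleftrightarrow> k < n \<and> bit r k" for r k :: nat
    by (metis bit_take_bit_iff take_bit_eq_mod)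
  show ?case
    unfolding upt list.map head kronecker_list_def foldr_Cons o_apply
    unfolding kronecker_list_def[symmetric] Suc.IH kronecker_mat_diag
    by (cases i a rule: linorder_cases; rule eq_matI) (auto simp: mat_diag_def top low)
qed

text \<open>The basis vector of index \<open>r\<close> has qubit \<open>i \<in> {1..N}\<close> in bit \<open>N - i\<close> of \<open>r\<close>.\<close>

definition spin :: "nat \<Rightarrow> nat \<Rightarrow> nat \<Rightarrow> int" where
  "spin N r i = (if bit r (N - i) then - 1 else 1)"

lemma sigma_z_at_eq_mat_diag:
  assumes "1 \<le> i" "i \<le> N"
  shows "sigma_z_at N i = mat_diag (2 ^ N) (\<lambda>r. of_int (spin N r i))"
  using assms kronecker_list_sigma_z[of i 1 N]
  unfolding sigma_z_at_def by (auto simp: spin_def if_distrib cong: if_cong simp del: upt_Suc)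

lemma finsum_mat_diag:
  assumes "finite A"
  shows "finsum (module_mat TYPE('a :: comm_ring_1) n n) (\<lambda>x. mat_diag n (f x)) A =
    mat_diag n (\<lambda>r. \<Sum>x\<in>A. f x r)"
proof -
  interpret M: abelian_monoid "module_mat TYPE('a) n n"
    using abelian_group_mat by (rule abelian_group.axioms(1))
  show ?thesis
    using assms
  proof induction
    case empty
    show ?case by (auto simp: module_mat_simps mat_diag_def)
  next
    case (insert x A)
    then show ?case
      by (subst M.finsum_insert) (auto simp: module_mat_simps mat_diag_def)
  qed
qed

text \<open>Expanding the square counts each unordered pair twice. Keeping the factor 2 on the left
  avoids division in the ring.\<close>

lemma two_times_sum_pairs:
  fixes s :: "nat \<Rightarrow> 'a :: comm_ring_1"
  shows "2 * (\<Sum>(i, j) | 1 \<le> i \<and> i < j \<and> j \<le> N. s i * s j) = (\<Sum>i=1..N. s i)\<^sup>2 - (\<Sum>i=1..N. (s i)\<^sup>2)"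
proof (induction N)
  case 0
  have empty: "{(i, j). 1 \<le> i \<and> i < j \<and> j \<le> (0::nat)} = {}" by auto
  show ?case unfolding empty by simp
next
  case (Suc N)
  let ?P = "\<lambda>N. {(i, j). 1 \<le> i \<and> i < j \<and> j \<le> (N::nat)}"
  have fin: "finite (?P N)" by (rule finite_subset[of _ "{..N} \<times> {..N}"]) auto
  have split: "?P (Suc N) = ?P N \<union> (\<lambda>i. (i, Suc N)) ` {1..N}" by (auto simp: le_Suc_eq)
  have "(\<Sum>(i, j)\<in>?P (Suc N). s i * s j) = (\<Sum>(i, j)\<in>?P N. s i * s j) + (\<Sum>i=1..N. s i * s (Suc N))"
    unfolding split using fin by (subst sum.union_disjoint) (auto simp: sum.reindex inj_on_def)
  then show ?case using Suc.IH
    by (simp add: distrib_left power2_eq_square sum_distrib_right[symmetric] algebra_simps)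
qed

definition magnetization :: "nat \<Rightarrow> nat \<Rightarrow> int" where
  "magnetization N r = (\<Sum>i=1..N. spin N r i)"

definition energy :: "nat \<Rightarrow> nat \<Rightarrow> real" where
  "energy N r = (of_int ((magnetization N r)\<^sup>2) - real N) / 2"

lemma h2_eq_mat_diag: "h2 N = mat_diag (2 ^ N) (\<lambda>r. complex_of_real (energy N r))"
proof -
  let ?P = "{(i, j). 1 \<le> i \<and> i < j \<and> j \<le> N}"
  let ?M = "module_mat TYPE(complex) (2 ^ N) (2 ^ N)"
  let ?s = "\<lambda>r i. complex_of_int (spin N r i)"
  have fin: "finite ?P" by (rule finite_subset[of _ "{..N} \<times> {..N}"]) auto
  interpret M: abelian_monoid ?M
    using abelian_group_mat by (rule abelian_group.axioms(1))
  have "h2 N = finsum ?M (\<lambda>x. mat_diag (2 ^ N) (\<lambda>r. case x of (i, j) \<Rightarrow> ?s r i * ?s r j)) ?P"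
    unfolding h2_def
    by (rule M.finsum_cong') (auto simp: sigma_z_at_eq_mat_diag module_mat_simps Pi_def)
  also have "\<dots> = mat_diag (2 ^ N) (\<lambda>r. \<Sum>(i, j)\<in>?P. ?s r i * ?s r j)"
    by (rule finsum_mat_diag[OF fin])
  also have "(\<lambda>r. \<Sum>(i, j)\<in>?P. ?s r i * ?s r j) = (\<lambda>r. complex_of_real (energy N r))"
  proof
    fix r
    \<comment> \<open>Spins square to 1, so the sum of squares in the pair identity is
      \<open>N\<close>.\<close>
    have "(?s r i)\<^sup>2 = 1" for i by (simp add: spin_def)
    with two_times_sum_pairs[of "?s r" N]
    have "2 * (\<Sum>(i, j)\<in>?P. ?s r i * ?s r j) = 2 * complex_of_real (energy N r)"
      by (simp add: energy_def magnetization_def)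
    then show "(\<Sum>(i, j)\<in>?P. ?s r i * ?s r j) = complex_of_real (energy N r)" by simp
  qed
  finally show ?thesis .
qed

text \<open>A sum of \<open>N\<close> odd numbers has the parity of \<open>N\<close>, hence is
  nonzero for odd \<open>N\<close>; the upper bound is the triangle inequality.\<close>

lemma magnetization_bounds:
  "of_bool (odd N) \<le> (magnetization N r)\<^sup>2" "(magnetization N r)\<^sup>2 \<le> (int N)\<^sup>2"
proof -
  have "odd (spin N r i)" for i by (simp add: spin_def)
  then have "even (\<Sum>i=1..n. spin N r i) \<longleftrightarrow> even n" for n
    by (induction n) auto
  then have "odd (magnetization N r)" if "odd N" using that by (simp add: magnetization_def)
  then have "odd N \<Longrightarrow> magnetization N r \<noteq> 0" by fastforce
  then have "1 \<le> (magnetization N r)\<^sup>2" if "odd N" using that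
    by (metis zero_less_power2 int_one_le_iff_zero_less)
  then show "of_bool (odd N) \<le> (magnetization N r)\<^sup>2" by simp
  have "\<bar>magnetization N r\<bar> \<le> (\<Sum>i=1..N. \<bar>spin N r i\<bar>)"
    unfolding magnetization_def by (rule sum_abs)
  also have "\<dots> = int N" by (simp add: spin_def if_distrib cong: if_cong)
  finally show "(magnetization N r)\<^sup>2 \<le> (int N)\<^sup>2"
    by (simp add: abs_le_square_iff[symmetric])
qed

text \<open>The index \<open>2 ^ k - 1\<close> has exactly its \<open>k\<close> lowest bits set, so
  \<open>k\<close> spins are flipped. This supplies the basis vectors of extreme energy.\<close>

lemma magnetization_mask:
  assumes "k \<le> N"
  shows "magnetization N (2 ^ k - 1) = int N - 2 * int k"
proof -
  have "magnetization N (2 ^ k - 1) = magnetization N (mask k)"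
    by (simp only: mask_eq_exp_minus_1)
  also have "\<dots> = (\<Sum>j<N. if j < k then - 1 else 1)"
    unfolding magnetization_def spin_def
    by (rule sum.reindex_bij_witness[of _ "\<lambda>j. N - j" "\<lambda>i. N - i"])
       (auto simp: bit_mask_iff)
  also have "{..<N} = {..<k} \<union> {k..<N}" using assms by auto
  also have "(\<Sum>j\<in>\<dots>. if j < k then - 1 else 1 :: int) = int N - 2 * int k"
    using assms by (subst sum.union_disjoint) (auto simp: of_nat_diff)
  finally show ?thesis .
qed

text \<open>Reduces quantum expectations of diagonal observables to classical means with the weights
  \<open>(cmod (\<psi> $ r))\<^sup>2\<close>.\<close>

lemma expectation_value_mat_diag:
  assumes "\<psi> \<in> carrier_vec n"
  shows "expectation_value (mat_diag n (\<lambda>r. complex_of_real (e r))) \<psi> =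
    of_real (\<Sum>r<n. e r * (cmod (\<psi> $ r))\<^sup>2)"
proof -
  have row: "(mat_diag n (\<lambda>r. complex_of_real (e r)) *\<^sub>v \<psi>) $ r = e r * \<psi> $ r" if "r < n" for r
    using assms that by (simp add: mat_diag_def scalar_prod_def if_distrib[where f = "\<lambda>x. x * _"]
        sum.delta cong: if_cong)
  show ?thesis
    using assms unfolding expectation_value_def scalar_prod_def
    by (auto simp: row lessThan_atLeast0 mult.assoc simp del: index_mult_mat_vec
        simp flip: complex_norm_square intro!: sum.cong)
qed

lemma self_inner_prod_eq:
  assumes "\<psi> \<in> carrier_vec n"
  shows "\<psi> \<bullet>c \<psi> = complex_of_real (\<Sum>r<n. (cmod (\<psi> $ r))\<^sup>2)"
  using assms unfolding scalar_prod_def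
  by (auto simp: lessThan_atLeast0 simp flip: complex_norm_square intro!: sum.cong)

text \<open>Popoviciu's inequality: the variance is at most \<open>(b - m) (m - a)\<close>, where \<open>m\<close> is the mean.\<close>

lemma variance_le:
  fixes e p :: "'i \<Rightarrow> real"
  assumes p: "\<And>r. r \<in> A \<Longrightarrow> p r \<ge> 0" "(\<Sum>r\<in>A. p r) = 1"
    and e: "\<And>r. r \<in> A \<Longrightarrow> a \<le> e r" "\<And>r. r \<in> A \<Longrightarrow> e r \<le> b"
  shows "4 * ((\<Sum>r\<in>A. (e r)\<^sup>2 * p r) - (\<Sum>r\<in>A. e r * p r)\<^sup>2) \<le> (b - a)\<^sup>2"
proof -
  let ?m = "\<Sum>r\<in>A. e r * p r"
  have "0 \<le> (\<Sum>r\<in>A. (e r - a) * (b - e r) * p r)"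
    using p e by (intro sum_nonneg mult_nonneg_nonneg) auto
  also have "\<dots> = (\<Sum>r\<in>A. (a + b) * (e r * p r) - a * b * p r - (e r)\<^sup>2 * p r)"
    by (intro sum.cong) (auto simp: algebra_simps power2_eq_square)
  also have "\<dots> = (a + b) * ?m - a * b - (\<Sum>r\<in>A. (e r)\<^sup>2 * p r)"
    by (simp add: sum_subtractf sum_distrib_left[symmetric] p)
  finally have "4 * ((\<Sum>r\<in>A. (e r)\<^sup>2 * p r) - ?m\<^sup>2) \<le> 4 * ((a + b) * ?m - a * b - ?m\<^sup>2)"
    by simp
  \<comment> \<open>Completes the square in \<open>4 * (b - ?m) * (?m - a)\<close>.\<close>
  also have "\<dots> = (b - a)\<^sup>2 - (a + b - 2 * ?m)\<^sup>2"
    by (simp add: algebra_simps power2_eq_square)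
  also have "\<dots> \<le> (b - a)\<^sup>2" by simp
  finally show ?thesis .
qed

theorem mainTheorem4:
  fixes N :: nat
  assumes "N \<ge> 2"
  shows "is_maximum_of
    (complex_of_real (1 / 16 * (2 * (real N)\<^sup>2 - 1 + (-1) ^ N)\<^sup>2))
    ((\<lambda>\<psi>. 4 * (expectation_value (h2 N ^\<^sub>m 2) \<psi> - (expectation_value (h2 N) \<psi>)\<^sup>2)) ` unit_vectors N)"
proof -
  define a where "a = (of_bool (odd N) - real N) / 2"
  define b where "b = ((real N)\<^sup>2 - real N) / 2"
  define p where "p \<psi> r = (cmod (\<psi> $ r))\<^sup>2" for \<psi> :: "complex vec" and r
  define V where "V \<psi> = 4 * ((\<Sum>r<2 ^ N. (energy N r)\<^sup>2 * p \<psi> r) - (\<Sum>r<2 ^ N. energy N r * p \<psi> r)\<^sup>2)" for \<psi>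
  \<comment> \<open>Since \<open>(-1) ^ N = 1 - 2 * of_bool (odd N)\<close>, the expression being
    squared on the left is \<open>4 * (b - a)\<close>.\<close>
  have max: "1 / 16 * (2 * (real N)\<^sup>2 - 1 + (-1) ^ N)\<^sup>2 = (b - a)\<^sup>2"
    by (cases "even N") (auto simp: a_def b_def power2_eq_square field_simps)
  have "h2 N ^\<^sub>m 2 = mat_diag (2 ^ N) (\<lambda>r. complex_of_real ((energy N r)\<^sup>2))"
    by (simp add: numeral_2_eq_2 h2_eq_mat_diag power2_eq_square)
  then have V: "4 * (expectation_value (h2 N ^\<^sub>m 2) \<psi> - (expectation_value (h2 N) \<psi>)\<^sup>2) = complex_of_real (V \<psi>)"
    if "\<psi> \<in> carrier_vec (2 ^ N)" for \<psi>
    using that unfolding h2_eq_mat_diag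
    by (simp only: expectation_value_mat_diag V_def p_def) simp
  have unit: "\<psi> \<in> unit_vectors N \<longleftrightarrow> \<psi> \<in> carrier_vec (2 ^ N) \<and> (\<Sum>r<2 ^ N. p \<psi> r) = 1" for \<psi>
    unfolding unit_vectors_def p_def by (auto simp: self_inner_prod_eq simp flip: of_real_sum)
  have energy: "a \<le> energy N r" "energy N r \<le> b" for r
  proof -
    have "real_of_int (of_bool (odd N)) \<le> real_of_int ((magnetization N r)\<^sup>2)"
      "real_of_int ((magnetization N r)\<^sup>2) \<le> real_of_int ((int N)\<^sup>2)"
      using magnetization_bounds[of N r] by (simp_all only: of_int_le_iff)
    then show "a \<le> energy N r" "energy N r \<le> b"
      unfolding a_def b_def energy_def by simp_all
  qed
  have upper: "V \<psi> \<le> (b - a)\<^sup>2" if "\<psi> \<in> unit_vectors N" for \<psi>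
    unfolding V_def using that energy by (intro variance_le) (auto simp: unit p_def)

  \<comment> \<open>Flipping half of the spins, rounded down, leaves magnetization
    \<open>N mod 2\<close>, hence energy \<open>a\<close>; index 0 has all spins up and energy
    \<open>b\<close>.\<close>
  define k where "k = N div 2"
  define r where "r = (2 :: nat) ^ k - 1"
  define \<phi> where "\<phi> = vec (2 ^ N) (\<lambda>x. if x = 0 \<or> x = r then complex_of_real (1 / sqrt 2) else 0)"
  \<comment> \<open>Here \<open>N \<ge> 2\<close> gives \<open>k > 0\<close>, so \<open>r\<close>
    differs from 0 and \<open>\<phi>\<close> superposes two distinct basis vectors.\<close>
  have k: "0 < k" "k \<le> N" using assms by (auto simp: k_def)
  have r: "0 < r" "r < 2 ^ N"
    using k power_increasing[of k N "2::nat"] one_less_power[of "2::nat" k]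
    unfolding r_def by (auto simp: less_diff_conv intro: less_le_trans)
  \<comment> \<open>Stated for arbitrary \<open>f\<close> to yield the norm, the mean and the second
    moment at once.\<close>
  have sum_\<phi>: "(\<Sum>x<2 ^ N. f x * p \<phi> x) = (f 0 + f r) / 2" for f
  proof -
    have "(\<Sum>x<2 ^ N. f x * p \<phi> x) = (\<Sum>x\<in>{0, r}. f x * p \<phi> x)"
      using r by (intro sum.mono_neutral_right) (auto simp: p_def \<phi>_def)
    also have "\<dots> = (f 0 + f r) / 2"
      using r by (simp add: p_def \<phi>_def norm_divide power_divide)
    finally show ?thesis .
  qed
  have \<phi>: "\<phi> \<in> unit_vectors N"
    using sum_\<phi>[of "\<lambda>_. 1"] by (simp add: unit \<phi>_def)
  have "energy N 0 = b"
    using magnetization_mask[of 0 N] by (simp add: energy_def b_def)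
  moreover have "energy N r = a"
  proof -
    have "int N - 2 * int k = of_bool (odd N)" unfolding k_def by (auto elim!: evenE oddE)
    then show ?thesis using magnetization_mask[of k N] k by (simp add: energy_def a_def r_def)
  qed
  \<comment> \<open>The two-point variance is \<open>(a\<^sup>2 + b\<^sup>2) / 2 - ((a + b) /
    2)\<^sup>2 = (b - a)\<^sup>2 / 4\<close>.\<close>
  ultimately have "V \<phi> = (b - a)\<^sup>2"
    unfolding V_def sum_\<phi> by (simp add: power2_eq_square field_simps)
  with \<phi> V[of \<phi>] upper V show ?thesis
    unfolding is_maximum_of_def max by (auto simp: unit less_eq_complex_def image_iff intro!: bexI[of _ \<phi>])
qed

end
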